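(* Let $G$ be a finite directed graph (loops and multiple edges allowed) with vertex set $\{1,\dots,m\}$ and edge set $\{1,\dots,n\}$, where edge $i$ goes from vertex $k(i)$ to vertex $j(i)$, and assume $G$ is a pseudoforest. Let $r_1,\dots,r_m$ be nonnegative integers and let $A_i$, $i=1,\dots,n$, be complex $r_{j(i)}\times r_{k(i)}$ matrices. Then there exist unitary matrices $U_1,\dots,U_m$, with $U_v$ of size $r_v\times r_v$, such that for every $i=1,\dots,n$ the matrix $T_i:=U_{j(i)}^{H}A_iU_{k(i)}$ is an $r_{j(i)}\times r_{k(i)}$ upper-triangular matrix.
   Context: $U^H$ denotes the conjugate transpose. A pseudoforest is a graph in which each connected component of the underlying undirected graph (ignoring edge directions) contains at most one cycle; a loop counts as a cycle of length 1 and two parallel edges between the same pair of vertices form a cycle of length 2. A square matrix $T$ is upper-triangular if $T_{ab}=0$ for $a>b$. A rectangular $p\times q$ matrix $T$ is called upper-triangular if it has one of the following forms: (a) $p>q$ and $T_{ab}=0$ whenever $a>b$; (b) $p<q$ and $T_{ab}=0$ whenever $b-a<q-p$; (c) $p>q$ and $T_{ab}=0$ whenever $a-b>p-q$; (d) $p<q$ and $T_{ab}=0$ whenever $a>b$. *)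

theory Defs
  imports "Graph_Theory.Digraph_Component" "Jordan_Normal_Form.Schur_Decomposition"
begin

text \<open>
  Cycles of the underlying undirected multigraph: edges may be traversed in either direction.
  The library notion \<^const>\<open>pre_digraph.cycle\<close> follows edge directions, and
  \<^const>\<open>mk_symmetric\<close> merges parallel edges, so neither can be used for this purpose.
\<close>

definition joins :: "('a, 'b) pre_digraph \<Rightarrow> 'b \<Rightarrow> 'a \<Rightarrow> 'a \<Rightarrow> bool" where
  "joins G e u v \<longleftrightarrow> e \<in> arcs G \<and>
     (tail G e = u \<and> head G e = v \<or> tail G e = v \<and> head G e = u)"

text \<open>
  The vertices and the edges of a cycle are pairwise distinct; length 1 gives the loops, and
  length 2 the pairs of parallel or antiparallel edges between two different vertices.
\<close>

definition undirected_cycle :: "('a, 'b) pre_digraph \<Rightarrow> 'a list \<Rightarrow> 'b list \<Rightarrow> bool" where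
  "undirected_cycle G vs es \<longleftrightarrow>
     vs \<noteq> [] \<and> length es = length vs \<and> distinct vs \<and> distinct es \<and>
     (\<forall>i < length vs. joins G (es ! i) (vs ! i) (vs ! (Suc i mod length vs)))"

text \<open>
  As a subgraph, a cycle is determined by its set of edges, regardless of starting point and
  orientation; this is what is counted below. Connected components are the maximal connected
  subgraphs, where \<^const>\<open>connected\<close> ignores edge directions.
\<close>

definition undirected_cycles :: "('a, 'b) pre_digraph \<Rightarrow> 'b set set" where
  "undirected_cycles G = {set es | vs es. undirected_cycle G vs es}"

definition pseudoforest :: "('a, 'b) pre_digraph \<Rightarrow> bool" where
  "pseudoforest G \<longleftrightarrow>
     (\<forall>C. pre_digraph.max_subgraph G connected C \<longrightarrow>
        (\<forall>c \<in> undirected_cycles C. \<forall>c' \<in> undirected_cycles C. c = c'))"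

definition unitary_mat :: "nat \<Rightarrow> complex mat \<Rightarrow> bool" where
  "unitary_mat r U \<longleftrightarrow> U \<in> carrier_mat r r \<and>
     mat_adjoint U * U = 1\<^sub>m r \<and> U * mat_adjoint U = 1\<^sub>m r"

text \<open>
  All conditions depend only on differences of indices, so counting from 0 instead of 1 makes
  no difference. The differences are taken in the integers to avoid truncation.
\<close>

definition zero_where :: "'a :: zero mat \<Rightarrow> (int \<Rightarrow> int \<Rightarrow> bool) \<Rightarrow> bool" where
  "zero_where T P \<longleftrightarrow>
     (\<forall>a < dim_row T. \<forall>b < dim_col T. P (int a) (int b) \<longrightarrow> T $$ (a, b) = 0)"

definition rect_upper_triangular :: "'a :: zero mat \<Rightarrow> bool" where
  "rect_upper_triangular T \<longleftrightarrow>
     (let p = int (dim_row T); q = int (dim_col T) in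
        p = q \<and> upper_triangular T \<or>
        p > q \<and> zero_where T (\<lambda>a b. a > b) \<or>
        p < q \<and> zero_where T (\<lambda>a b. b - a < q - p) \<or>
        p > q \<and> zero_where T (\<lambda>a b. a - b > p - q) \<or>
        p < q \<and> zero_where T (\<lambda>a b. a > b))"

end

theory Submission
  imports Defs "Jordan_Normal_Form.Spectral_Radius"
begin

text \<open>
  Form (a) implies (c) and form (b) implies (d), so only the square form, (c) and (d) are used;
  together they say that \<open>T a b = 0\<close> whenever \<open>a - b > max 0 (p - q)\<close>.
  In terms of the flags \<open>F v\<close> spanned by the first columns of the \<open>U
  v\<close>, this says that \<open>A i\<close> maps \<open>F k s\<close> into \<open>F j (s +
  max 0 (p - q))\<close> for every \<open>s\<close>, which makes an induction by splitting off
  lines possible. Suppose there are a nonempty vertex set \<open>S\<close> and a line at each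
  vertex of \<open>S\<close> such that along an edge inside \<open>S\<close> the line is mapped
  into the line, along an edge leaving \<open>S\<close> the line is killed, and every edge
  entering \<open>S\<close> strictly increases the dimension. Take these lines as first members
  of the flags and pass to the quotients by them.

  Such a system of lines grows along an edge to a new vertex without obstruction: forwards take
  the image of the line or stop if it is zero; backwards stop if the matrix has more rows than
  columns, otherwise the line has a nonzero preimage. Hence only a cycle can obstruct. If a
  matrix \<open>A i\<close> on the cycle is not injective, start with a line in its kernel and
  go round the rest of the cycle. If all are injective and some strictly increase the dimension,
  remove the latter and start from a vertex of maximal dimension. If all are invertible, use an
  eigenvector of the product of the \<open>A i\<close> and their inverses round the cycle.
\<close>

section \<open>Matrices\<close>

lemma mat_adjoint_dim [simp]:
  "dim_row (mat_adjoint A) = dim_col A" "dim_col (mat_adjoint A) = dim_row A"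
  by (simp_all add: mat_adjoint_def)

lemma mat_adjoint_carrier [simp]:
  "A \<in> carrier_mat p q \<Longrightarrow> mat_adjoint A \<in> carrier_mat q p"
  by (intro carrier_matI) auto

lemma mat_adjoint_index [simp]:
  "i < dim_col A \<Longrightarrow> j < dim_row A \<Longrightarrow> mat_adjoint A $$ (i, j) = conjugate (A $$ (j, i))"
  by (simp add: mat_adjoint_def mat_of_rows_index)

lemma mat_adjoint_mult:
  fixes A B :: "complex mat"
  assumes "A \<in> carrier_mat p q" "B \<in> carrier_mat q s"
  shows "mat_adjoint (A * B) = mat_adjoint B * mat_adjoint A"
proof (rule eq_matI)
  fix i j assume "i < dim_row (mat_adjoint B * mat_adjoint A)" "j < dim_col (mat_adjoint B * mat_adjoint A)"
  then show "mat_adjoint (A * B) $$ (i, j) = (mat_adjoint B * mat_adjoint A) $$ (i, j)"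
    using assms by (auto simp: scalar_prod_def mult.commute intro!: sum.cong)
qed (use assms in auto)

lemma unitary_mat_one: "unitary_mat n (1\<^sub>m n)"
proof -
  have "mat_adjoint (1\<^sub>m n :: complex mat) = 1\<^sub>m n" by (rule eq_matI) auto
  then show ?thesis by (simp add: unitary_mat_def)
qed

lemma unitary_mat_mult:
  assumes "unitary_mat n P" "unitary_mat n Q"
  shows "unitary_mat n (P * Q)"
proof -
  have P: "P \<in> carrier_mat n n" "mat_adjoint P \<in> carrier_mat n n"
    and Q: "Q \<in> carrier_mat n n" "mat_adjoint Q \<in> carrier_mat n n"
    using assms by (auto simp: unitary_mat_def)
  have "mat_adjoint Q * mat_adjoint P * (P * Q) = mat_adjoint Q * (mat_adjoint P * P) * Q"
    using P Q by (simp add: assoc_mult_mat[of _ n n _ n _ n] mult_carrier_mat[of _ n n _ n])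
  moreover have "P * Q * (mat_adjoint Q * mat_adjoint P) = P * (Q * mat_adjoint Q) * mat_adjoint P"
    using P Q by (simp add: assoc_mult_mat[of _ n n _ n _ n] mult_carrier_mat[of _ n n _ n])
  ultimately show ?thesis
    using assms P Q unfolding unitary_mat_def
    by (simp add: mat_adjoint_mult[OF P(1) Q(1)])
qed

text \<open>Lifts a unitary matrix of a quotient to the whole space; in the induction
  \<open>k\<close> is 1 at a vertex whose line is split off and 0 at the others.\<close>

lemma unitary_mat_block:
  assumes "unitary_mat n W"
  shows "unitary_mat (k + n) (four_block_mat (1\<^sub>m k) (0\<^sub>m k n) (0\<^sub>m n k) W)" (is "unitary_mat _ ?W")
    and "mat_adjoint (four_block_mat (1\<^sub>m k) (0\<^sub>m k n) (0\<^sub>m n k) W)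
      = four_block_mat (1\<^sub>m k) (0\<^sub>m k n) (0\<^sub>m n k) (mat_adjoint W)"
proof -
  have W: "W \<in> carrier_mat n n" "mat_adjoint W \<in> carrier_mat n n" 
    "mat_adjoint W * W = 1\<^sub>m n" "W * mat_adjoint W = 1\<^sub>m n"
    using assms by (auto simp: unitary_mat_def)
  show adj: "mat_adjoint ?W = four_block_mat (1\<^sub>m k) (0\<^sub>m k n) (0\<^sub>m n k) (mat_adjoint W)"
    by (rule eq_matI) (use W in auto)
  show "unitary_mat (k + n) ?W"
    unfolding unitary_mat_def adj using W
    by (auto simp: mult_four_block_mat[of _ k k _ n _ n _ _ k _ n])
qed

text \<open>Gram-Schmidt on a basis that starts with \<open>v\<close> keeps \<open>v\<close> in
  front and makes the vectors orthogonal; scaling them to norm 1 gives the columns, so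
  \<open>c\<close> is the inverse norm of \<open>v\<close>.\<close>

lemma exists_unitary_mat_col_0:
  assumes v: "v \<in> carrier_vec n" "v \<noteq> 0\<^sub>v n"
  obtains Q c where "unitary_mat n Q" "c \<noteq> 0" "col Q 0 = c \<cdot>\<^sub>v v"
proof -
  interpret cof_vec_space n "TYPE(complex)" .
  have n: "0 < n" using v by (cases n) auto
  define ws where "ws = gram_schmidt n (basis_completion v)"
  note bc = basis_completion[OF v]
  note gs = gram_schmidt_result[OF bc(2,4,5) ws_def]
  have len: "length ws = n" using gs(4) bc(6) by simp
  obtain vs where "basis_completion v = v # vs"
    using bc(6,7) n by (cases "basis_completion v") auto
  then have "hd ws = v" using gram_schmidt_hd[OF v(1), of vs] ws_def by simp
  then have ws0: "ws ! 0 = v" using len n by (cases ws) auto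
  have carr: "ws ! i \<in> carrier_vec n" if "i < n" for i using gs(3) len that by auto
  define d where "d i = complex_of_real (1 / sqrt (\<Sum>k<n. (cmod (ws ! i $ k))\<^sup>2))" for i
  have sp: "ws ! i \<bullet>c ws ! i = complex_of_real (\<Sum>k<n. (cmod (ws ! i $ k))\<^sup>2)" if "i < n" for i
    using carr[OF that] by (auto simp: scalar_prod_def atLeast0LessThan complex_norm_square[symmetric] simp del: of_real_power)
  have dd: "d i * cnj (d i) * (ws ! i \<bullet>c ws ! i) = 1" if "i < n" for i
  proof -
    let ?s = "\<Sum>k<n. (cmod (ws ! i $ k))\<^sup>2"
    have "ws ! i \<bullet>c ws ! i \<noteq> 0" using corthogonalD[OF gs(2), of i i] len that by auto
    then have "?s \<noteq> 0" using sp[OF that] by (metis of_real_0)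
    moreover have "?s \<ge> 0" by (rule sum_nonneg) simp
    ultimately have "1 / sqrt ?s * (1 / sqrt ?s) * ?s = 1" by simp
    then have "complex_of_real (1 / sqrt ?s * (1 / sqrt ?s) * ?s) = 1" by (simp only: of_real_1)
    then show ?thesis unfolding sp[OF that] d_def complex_cnj_complex_of_real of_real_mult .
  qed
  define Q where "Q = mat n n (\<lambda>(k, i). d i * ws ! i $ k)"
  have Q: "Q \<in> carrier_mat n n" by (simp add: Q_def)
  have QQ: "mat_adjoint Q * Q = 1\<^sub>m n"
  proof (rule eq_matI)
    fix i j assume ij: "i < dim_row (1\<^sub>m n)" "j < dim_col (1\<^sub>m n)"
    then have "(mat_adjoint Q * Q) $$ (i, j) = cnj (d i) * d j * (ws ! j \<bullet>c ws ! i)"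
      using Q carr[of i] carr[of j]
      by (auto simp: Q_def scalar_prod_def sum_distrib_left mult_ac intro!: sum.cong)
    then show "(mat_adjoint Q * Q) $$ (i, j) = 1\<^sub>m n $$ (i, j)"
      using corthogonalD[OF gs(2), of j i] ij len dd[of i] by (auto simp: mult_ac)
  qed (use Q in auto)
  have "unitary_mat n Q"
    unfolding unitary_mat_def using Q QQ mat_mult_left_right_inverse[OF _ Q QQ] by simp
  moreover have "d 0 \<noteq> 0" using dd[OF n] by auto
  moreover have "col Q 0 = d 0 \<cdot>\<^sub>v v"
    by (rule eq_vecI) (use n v(1) ws0 Q in \<open>auto simp: Q_def\<close>)
  ultimately show thesis by (rule that)
qed

text \<open>Padding \<open>A\<close> with zero rows gives a square matrix \<open>M\<close>. As
  \<open>p < q\<close>, it has a zero row and is singular, and whatever it kills is killed by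
  \<open>A\<close>.\<close>

lemma exists_kernel_vec:
  fixes A :: "'a :: field mat"
  assumes A: "A \<in> carrier_mat p q" and "p < q"
  obtains z where "z \<in> carrier_vec q" "z \<noteq> 0\<^sub>v q" "A *\<^sub>v z = 0\<^sub>v p"
proof -
  define M where "M = mat q q (\<lambda>(i, j). if i < p then A $$ (i, j) else 0)"
  have M: "M \<in> carrier_mat q q" by (simp add: M_def)
  have "det M = 0"
  proof -
    have "row M p = 0\<^sub>v q" by (rule eq_vecI) (use assms in \<open>auto simp: M_def\<close>)
    \<comment> \<open>The zero row \<open>p\<close> becomes a zero column of the transpose, which
      thus kills a standard basis vector.\<close>
    then have "transpose_mat M *\<^sub>v unit_vec q p = 0\<^sub>v q"
      by (intro eq_vecI) (use M assms(2) in \<open>auto simp: M_def\<close>)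
    then have "det (transpose_mat M) = 0"
      using det_0_iff_vec_prod_zero[OF transpose_carrier_mat[THEN iffD2, OF M]] assms(2)
        unit_vec_nonzero[of p q] unit_vec_carrier[of q p] by blast
    then show ?thesis using det_transpose[OF M] by simp
  qed
  then obtain z where z: "z \<in> carrier_vec q" "z \<noteq> 0\<^sub>v q" "M *\<^sub>v z = 0\<^sub>v q"
    using det_0_iff_vec_prod_zero[OF M] by blast
  have "A *\<^sub>v z = 0\<^sub>v p"
  proof (rule eq_vecI)
    fix i assume i: "i < dim_vec (0\<^sub>v p :: 'a vec)"
    then have "row A i = row M i" by (intro eq_vecI) (use assms in \<open>auto simp: M_def\<close>)
    then have "(A *\<^sub>v z) $ i = (M *\<^sub>v z) $ i" using i assms M by auto
    then show "(A *\<^sub>v z) $ i = 0\<^sub>v p $ i" using z(3) i assms by simp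
  qed (use A in auto)
  with z that show thesis by blast
qed

text \<open>The block matrix \<open>[A | -l]\<close> has more columns than rows, hence a kernel
  vector \<open>y\<close>; its first \<open>q\<close> entries form \<open>z\<close> and the last one
  is \<open>c\<close>. The case \<open>c = 0\<close> is allowed: then \<open>z\<close> is in the
  kernel of \<open>A\<close>, which also maps it into the line.\<close>

lemma exists_preimage_line:
  fixes A :: "'a :: field mat"
  assumes A: "A \<in> carrier_mat p q" and pq: "p \<le> q" and l: "l \<in> carrier_vec p" "l \<noteq> 0\<^sub>v p"
  obtains z c where "z \<in> carrier_vec q" "z \<noteq> 0\<^sub>v q" "A *\<^sub>v z = c \<cdot>\<^sub>v l"
proof -
  define M where "M = mat p (Suc q) (\<lambda>(i, j). if j < q then A $$ (i, j) else - l $ i)"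
  have M: "M \<in> carrier_mat p (Suc q)" by (simp add: M_def)
  obtain y where y: "y \<in> carrier_vec (Suc q)" "y \<noteq> 0\<^sub>v (Suc q)" "M *\<^sub>v y = 0\<^sub>v p"
    using exists_kernel_vec[OF M] pq by auto
  define z where "z = vec q (($) y)"
  have z: "z \<in> carrier_vec q" by (simp add: z_def)
  have Az: "A *\<^sub>v z = y $ q \<cdot>\<^sub>v l"
  proof (rule eq_vecI)
    fix i assume "i < dim_vec (y $ q \<cdot>\<^sub>v l)"
    then have i: "i < p" using l by simp
    have "(M *\<^sub>v y) $ i = (\<Sum>j<q. A $$ (i, j) * y $ j) - l $ i * y $ q"
      using i y(1) M by (simp add: scalar_prod_def M_def atLeast0LessThan)
    also have "(\<Sum>j<q. A $$ (i, j) * y $ j) = (A *\<^sub>v z) $ i"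
      using i A by (auto simp add: scalar_prod_def z_def atLeast0LessThan)
    finally show "(A *\<^sub>v z) $ i = (y $ q \<cdot>\<^sub>v l) $ i"
      using y(3) i l by (simp add: mult.commute)
  qed (use A l in auto)
  \<comment> \<open>If \<open>z\<close> were 0, then \<open>c\<close> times the nonzero vector
    \<open>l\<close> would be 0, so the last entry of \<open>y\<close> would vanish too.\<close>
  have "z \<noteq> 0\<^sub>v q"
  proof
    assume z0: "z = 0\<^sub>v q"
    then have "A *\<^sub>v z = 0\<^sub>v p" using A by auto
    then have "y $ q \<cdot>\<^sub>v l = 0\<^sub>v p" using Az by simp
    moreover obtain i where i: "i < p" "l $ i \<noteq> 0"
      using l by (metis carrier_vecD eq_vecI index_zero_vec(1) index_zero_vec(2))
    ultimately have "y $ q * l $ i = 0"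
      using l(1) by (metis carrier_vecD index_smult_vec(1) index_zero_vec(1))
    then have "y $ q = 0" using i by simp
    moreover have "y $ j = 0" if "j < q" for j
      using arg_cong[OF z0, of "\<lambda>v. v $ j"] that by (simp add: z_def)
    ultimately have "y = 0\<^sub>v (Suc q)"
      using y(1) by (intro eq_vecI) (auto simp: less_Suc_eq)
    with y(2) show False ..
  qed
  with z Az that show thesis by blast
qed

section \<open>Staircase matrices\<close>

text \<open>The truncated difference of the dimensions is the bound \<open>max 0 (p - q)\<close>.\<close>

definition staircase :: "'a :: zero mat \<Rightarrow> bool" where
  "staircase T \<longleftrightarrow>
     (\<forall>a < dim_row T. \<forall>b < dim_col T. b + (dim_row T - dim_col T) < a \<longrightarrow> T $$ (a, b) = 0)"

lemma staircase_imp_rect_upper_triangular: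
  "staircase T \<Longrightarrow> rect_upper_triangular T"
  unfolding staircase_def rect_upper_triangular_def zero_where_def upper_triangular_def Let_def
  by (cases "dim_row T" "dim_col T" rule: linorder_cases) auto

text \<open>Here \<open>s\<close> and \<open>t\<close> tell whether a line was split off at the head
  and at the tail. For \<open>s = t\<close> the bound is unchanged and both indices shift together.
  For \<open>s = 0\<close>, \<open>t = 1\<close> the column shift makes up for a smaller bound. For
  \<open>s = 1\<close>, \<open>t = 0\<close> the bound has to grow by 1, which the truncated
  difference does just when \<open>q \<le> p\<close>.\<close>

lemma staircase_block:
  assumes B: "B1 \<in> carrier_mat s t" "B2 \<in> carrier_mat s q" "T \<in> carrier_mat p q" "staircase T"
    and st: "s \<le> 1" "t \<le> 1" "s = 1 \<Longrightarrow> t = 0 \<Longrightarrow> q \<le> p"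
  shows "staircase (four_block_mat B1 B2 (0\<^sub>m p t) T)"
  unfolding staircase_def
proof (intro allI impI)
  let ?F = "four_block_mat B1 B2 (0\<^sub>m p t) T"
  fix a b assume a: "a < dim_row ?F" and b: "b < dim_col ?F"
    and ab: "b + (dim_row ?F - dim_col ?F) < a"
  \<comment> \<open>The entries concerned have \<open>a \<ge> 1\<close>, so they lie in the two
    lower blocks.\<close>
  have sa: "s \<le> a" using ab st(1) by linarith
  show "?F $$ (a, b) = 0"
  proof (cases "b < t")
    case True
    then show ?thesis using sa a b B by auto
  next
    case False
    have "(b - t) + (p - q) < a - s"
      using st False sa ab B by (cases "s = 1"; cases "t = 1"; cases "q \<le> p"; auto simp: le_Suc_eq)
    then have "T $$ (a - s, b - t) = 0"
      using B a b False sa unfolding staircase_def by auto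
    then show ?thesis using False sa a b B by auto
  qed
qed

section \<open>Undirected paths and cycles\<close>

text \<open>Relative to an edge set, since later arguments add edges one by one or remove them from
  a cycle.\<close>

definition link :: "('a, 'b) pre_digraph \<Rightarrow> 'b set \<Rightarrow> ('a \<times> 'a) set" where
  "link G E = {(u, v). \<exists>e \<in> E. joins G e u v}"

lemma joins_sym: "joins G e u v \<longleftrightarrow> joins G e v u"
  by (auto simp: joins_def)

lemma joins_ends: "joins G e u v \<Longrightarrow> {tail G e, head G e} = {u, v}"
  by (auto simp: joins_def)

lemma link_mono: "E \<subseteq> F \<Longrightarrow> (link G E)\<^sup>* \<subseteq> (link G F)\<^sup>*"
  by (rule rtrancl_mono) (auto simp: link_def)

lemma link_sym: "(u, v) \<in> (link G E)\<^sup>* \<Longrightarrow> (v, u) \<in> (link G E)\<^sup>*"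
proof -
  have "sym (link G E)" by (auto simp: sym_def link_def joins_sym)
  then have "sym ((link G E)\<^sup>*)" by (rule sym_rtrancl)
  then show "(u, v) \<in> (link G E)\<^sup>* \<Longrightarrow> (v, u) \<in> (link G E)\<^sup>*" by (rule symD)
qed

definition undirected_path :: "('a, 'b) pre_digraph \<Rightarrow> 'a list \<Rightarrow> 'b list \<Rightarrow> bool" where
  "undirected_path G vs es \<longleftrightarrow> length vs = Suc (length es) \<and> distinct vs \<and> distinct es \<and>
     (\<forall>i < length es. joins G (es ! i) (vs ! i) (vs ! Suc i))"

text \<open>A walk is shortened as it is built: if the next vertex is already on the path, cut the
  path there; otherwise append it.\<close>

lemma linked_imp_undirected_path:
  assumes "(u, v) \<in> (link G E)\<^sup>*"
  shows "\<exists>vs es. undirected_path G vs es \<and> set es \<subseteq> E \<and> vs ! 0 = u \<and> vs ! length es = v"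
  using assms
proof (induction rule: rtrancl_induct)
  case base
  show ?case by (rule exI[of _ "[u]"], rule exI[of _ "[]"]) (simp add: undirected_path_def)
next
  case (step y z)
  then obtain vs es e where p: "undirected_path G vs es" "set es \<subseteq> E" "vs ! 0 = u" "vs ! length es = y"
    and e: "e \<in> E" "joins G e y z"
    by (auto simp: link_def)
  have len: "length vs = Suc (length es)" using p(1) by (simp add: undirected_path_def)
  show ?case
  proof (cases "z \<in> set vs")
    case True
    then obtain k where k: "k < length vs" "vs ! k = z" by (auto simp: in_set_conv_nth)
    have "undirected_path G (take (Suc k) vs) (take k es)"
      using p(1) k len by (auto simp: undirected_path_def)
    moreover have "set (take k es) \<subseteq> E" using p(2) set_take_subset by fastforce
    ultimately show ?thesis
      using k len p(3) by (intro exI[of _ "take (Suc k) vs"] exI[of _ "take k es"]) auto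
  next
    case False
    \<comment> \<open>An edge of the path has both ends on the path, but \<open>z\<close> is not on
      it.\<close>
    have "e \<notin> set es"
    proof
      assume "e \<in> set es"
      then obtain i where i: "i < length es" "es ! i = e" by (auto simp: in_set_conv_nth)
      then have "joins G e (vs ! i) (vs ! Suc i)" using p(1) by (auto simp: undirected_path_def)
      then have "z = vs ! i \<or> z = vs ! Suc i" using joins_ends[OF e(2)] joins_ends by fastforce
      then show False using False i len by auto
    qed
    then have "undirected_path G (vs @ [z]) (es @ [e])"
      using p(1,4) False len e(2)
      by (auto simp: undirected_path_def nth_append less_Suc_eq)
    then show ?thesis
      using p e len by (intro exI[of _ "vs @ [z]"] exI[of _ "es @ [e]"]) (auto simp: nth_append)
  qed
qed

text \<open>The edge \<open>e\<close> leads back from the end of a path in \<open>E\<close> to its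
  start. For \<open>u = v\<close> the path has no edges and the cycle is the loop
  \<open>e\<close>.\<close>

lemma chord_closes_cycle:
  assumes "(u, v) \<in> (link G E)\<^sup>*" "e \<notin> E" "joins G e u v"
  obtains vs es where "undirected_cycle G vs es" "set es \<subseteq> insert e E" "e \<in> set es" "u \<in> set vs"
proof -
  obtain vs es where p: "undirected_path G vs es" "set es \<subseteq> E" "vs ! 0 = u" "vs ! length es = v"
    using linked_imp_undirected_path[OF assms(1)] by blast
  have len: "length vs = Suc (length es)" using p(1) by (simp add: undirected_path_def)
  have "undirected_cycle G vs (es @ [e])"
    unfolding undirected_cycle_def
  proof (intro conjI allI impI)
    fix i assume "i < length vs"
    then consider "i < length es" | "i = length es" using len by linarith
    then show "joins G ((es @ [e]) ! i) (vs ! i) (vs ! (Suc i mod length vs))"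
    proof cases
      case 1
      then show ?thesis using p(1) len by (auto simp: undirected_path_def nth_append)
    next
      case 2
      then show ?thesis using p(3,4) len assms(3) by (simp add: joins_sym)
    qed
  qed (use p len assms(2) in \<open>auto simp: undirected_path_def\<close>)
  moreover have "u \<in> set vs" using p(3) len by (metis nth_mem zero_less_Suc)
  ultimately show thesis using p(2) by (intro that[of vs "es @ [e]"]) auto
qed

lemma undirected_cycle_ends:
  assumes "undirected_cycle G vs es" "e \<in> set es"
  shows "e \<in> arcs G" "tail G e \<in> set vs" "head G e \<in> set vs"
proof -
  obtain i where "i < length vs" "joins G e (vs ! i) (vs ! (Suc i mod length vs))"
    using assms by (auto simp: undirected_cycle_def in_set_conv_nth)
  moreover from this have "Suc i mod length vs < length vs" by (intro mod_less_divisor) auto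
  ultimately show "e \<in> arcs G" "tail G e \<in> set vs" "head G e \<in> set vs"
    by (auto simp: joins_def)
qed

lemma undirected_cycle_linked:
  assumes "undirected_cycle G vs es" "u \<in> set vs" "v \<in> set vs"
  shows "(u, v) \<in> (link G (set es))\<^sup>*"
proof -
  have *: "(vs ! 0, vs ! i) \<in> (link G (set es))\<^sup>*" if "i < length vs" for i
    using that
  proof (induction i)
    case (Suc i)
    then have "joins G (es ! i) (vs ! i) (vs ! Suc i)"
      using assms(1) by (auto simp: undirected_cycle_def dest: spec[of _ i])
    moreover have "es ! i \<in> set es" using Suc assms(1) by (auto simp: undirected_cycle_def)
    ultimately have "(vs ! i, vs ! Suc i) \<in> link G (set es)" by (auto simp: link_def)
    with Suc show ?case by (meson Suc_lessD rtrancl.rtrancl_into_rtrancl)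
  qed simp
  obtain i j where "u = vs ! i" "i < length vs" "v = vs ! j" "j < length vs"
    using assms(2,3) by (auto simp: in_set_conv_nth)
  with * show ?thesis by (metis link_sym rtrancl_trans)
qed

lemma linked_in_cycle:
  assumes "undirected_cycle G vs es" "(u, v) \<in> (link G (set es))\<^sup>*" "u \<in> set vs"
  shows "v \<in> set vs"
  using assms(2,3)
proof (induction rule: rtrancl_induct)
  case (step y z)
  then obtain e where "e \<in> set es" "joins G e y z" by (auto simp: link_def)
  then show ?case using undirected_cycle_ends[OF assms(1)] by (auto simp: joins_def)
qed

text \<open>The pseudoforest condition in terms of linked vertices, which replaces maximal connected
  subgraphs from here on.\<close>

definition unicyclic_components :: "('a, 'b) pre_digraph \<Rightarrow> bool" where
  "unicyclic_components G \<longleftrightarrow>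
     (\<forall>vs es vs' es'. undirected_cycle G vs es \<longrightarrow> undirected_cycle G vs' es' \<longrightarrow>
        (\<exists>u \<in> set vs. \<exists>u' \<in> set vs'. (u, u') \<in> (link G (arcs G))\<^sup>*) \<longrightarrow> set es = set es')"

text \<open>The set \<open>X\<close> of vertices linked to \<open>u\<close> induces a maximal
  connected subgraph \<open>C\<close>. Both cycles lie in \<open>C\<close>, so they have the same
  edges.\<close>

lemma pseudoforest_imp_unicyclic_components:
  assumes "wf_digraph G" "pseudoforest G"
  shows "unicyclic_components G"
  unfolding unicyclic_components_def
proof (intro allI impI)
  fix vs es vs' es'
  assume c: "undirected_cycle G vs es" and c': "undirected_cycle G vs' es'"
    and "\<exists>u \<in> set vs. \<exists>u' \<in> set vs'. (u, u') \<in> (link G (arcs G))\<^sup>*"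
  then obtain u u' where u: "u \<in> set vs" "u' \<in> set vs'" "(u, u') \<in> (link G (arcs G))\<^sup>*" by blast
  interpret wf_digraph G by fact
  define X where "X = {v. (u, v) \<in> (link G (arcs G))\<^sup>*}"
  define C where "C = G \<restriction> X"
  have arcsX: "tail G e \<in> X \<longleftrightarrow> head G e \<in> X" if "e \<in> arcs G" for e
  proof -
    have "(tail G e, head G e) \<in> link G (arcs G)" "(head G e, tail G e) \<in> link G (arcs G)"
      using that by (auto simp: link_def joins_def)
    then show ?thesis unfolding X_def by (auto intro: rtrancl.rtrancl_into_rtrancl)
  qed
  have "(u, v) \<in> (link G (arcs G))\<^sup>*" if "v \<in> set vs" for v
    using undirected_cycle_linked[OF c u(1) that] link_mono[of "set es" "arcs G" G]
      undirected_cycle_ends(1)[OF c] by blast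
  then have vsX: "set vs \<subseteq> X" by (auto simp: X_def)
  have "(u, v) \<in> (link G (arcs G))\<^sup>*" if "v \<in> set vs'" for v
    using undirected_cycle_linked[OF c' u(2) that] link_mono[of "set es'" "arcs G" G]
      undirected_cycle_ends(1)[OF c'] u(3) by (meson rtrancl_trans subsetD subsetI)
  then have vsX': "set vs' \<subseteq> X" by (auto simp: X_def)
  have cyc: "undirected_cycle C ws fs" if "undirected_cycle G ws fs" "set ws \<subseteq> X" for ws fs
  proof -
    have "fs ! i \<in> arcs C" if "i < length ws" for i
    proof -
      have "fs ! i \<in> set fs" using that \<open>undirected_cycle G ws fs\<close> by (auto simp: undirected_cycle_def)
      then show ?thesis
        using undirected_cycle_ends[OF \<open>undirected_cycle G ws fs\<close>] \<open>set ws \<subseteq> X\<close>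
        by (auto simp: C_def)
    qed
    with that(1) show ?thesis
      by (auto simp: undirected_cycle_def joins_def C_def)
  qed
  have uX: "u \<in> X" by (simp add: X_def)
  \<comment> \<open>An arc at \<open>u\<close> is what shows that \<open>u\<close> is a vertex of
    \<open>G\<close>: the definition of a cycle speaks of membership for edges only.\<close>
  obtain e where "e \<in> set es" "tail G e = u \<or> head G e = u"
  proof -
    obtain i where "i < length vs" "vs ! i = u" using u(1) by (auto simp: in_set_conv_nth)
    then show thesis using c that[of "es ! i"] by (auto simp: undirected_cycle_def joins_def)
  qed
  have X_verts: "X \<subseteq> verts G"
  proof
    fix v assume "v \<in> X"
    then have "(u, v) \<in> (link G (arcs G))\<^sup>*" by (simp add: X_def)
    then show "v \<in> verts G"
    proof (cases rule: rtranclE)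
      case base
      then show ?thesis using \<open>tail G e = u \<or> head G e = u\<close> undirected_cycle_ends(1)[OF c \<open>e \<in> set es\<close>] by auto
    next
      case (step y)
      then show ?thesis by (auto simp: link_def joins_def)
    qed
  qed
  have sub: "subgraph C G" unfolding C_def by (rule subgraph_induce_subgraphI[OF X_verts])
  have reach: "(u, v) \<in> rtrancl_on X (parcs (mk_symmetric C))" if "(u, v) \<in> (link G (arcs G))\<^sup>*" for v
    using that
  proof (induction rule: rtrancl_induct)
    case base
    show ?case using uX by simp
  next
    case (step y z)
    then have "y \<in> X" "z \<in> X" by (auto simp: X_def intro: rtrancl.rtrancl_into_rtrancl)
    moreover have "(y, z) \<in> parcs (mk_symmetric C)"
      using step(2) \<open>y \<in> X\<close> \<open>z \<in> X\<close> by (auto simp: link_def joins_def parcs_mk_symmetric C_def)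
    ultimately show ?case using step.IH by (meson rtrancl_on_into_rtrancl_on)
  qed
  have "connected C"
  proof -
    have "v \<rightarrow>\<^sup>*\<^bsub>mk_symmetric C\<^esub> w" if "v \<in> X" "w \<in> X" for v w
    proof -
      have uv: "u \<rightarrow>\<^sup>*\<^bsub>mk_symmetric C\<^esub> v" and uw: "u \<rightarrow>\<^sup>*\<^bsub>mk_symmetric C\<^esub> w"
        using reach that by (auto simp: X_def reachable_def C_def)
      show ?thesis
        using symmetric_reachable[OF symmetric_mk_symmetric uv] uw
        unfolding reachable_def by (rule rtrancl_on_trans)
    qed
    then show ?thesis using uX by (auto simp: connected_def strongly_connected_def C_def)
  qed
  have "max_subgraph connected C"
  proof (rule max_subgraphI[where P = connected, OF \<open>connected C\<close> sub])
    fix H assume H: "C \<noteq> H" "subgraph C H" "subgraph H G"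
    show "\<not> connected H"
    proof
      assume conn: "connected H"
      \<comment> \<open>Walks of \<open>H\<close> use arcs of \<open>G\<close>, and no arc of
        \<open>G\<close> has just one end in \<open>X\<close>.\<close>
      have "verts H \<subseteq> X"
      proof
        fix v assume v: "v \<in> verts H"
        have "u \<in> verts H" using H(2) uX by (auto simp: C_def subgraph_def)
        with v conn have "u \<rightarrow>\<^sup>*\<^bsub>mk_symmetric H\<^esub> v"
          by (auto simp: connected_def)
        then have "(u, v) \<in> rtrancl_on (verts H) (parcs (mk_symmetric H))"
          by (simp add: reachable_def)
        then show "v \<in> X"
        proof (induction rule: rtrancl_on_induct)
          case (step y z)
          then obtain f where f: "f \<in> arcs H" "(y, z) = (tail H f, head H f) \<or> (y, z) = (head H f, tail H f)"
            by (auto simp: parcs_mk_symmetric)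
          moreover have "f \<in> arcs G" "tail H = tail G" "head H = head G"
            using f(1) H(3) by (auto simp: subgraph_def compatible_def)
          ultimately show ?case using arcsX[of f] step by auto
        qed (rule uX)
      qed
      moreover have "X \<subseteq> verts H" using H(2) by (auto simp: C_def subgraph_def)
      ultimately have "verts H = X" by blast
      then have "arcs H \<subseteq> arcs C"
        using H(3) wf_digraph.wellformed[of H] by (auto simp: subgraph_def compatible_def C_def)
      with H(2) \<open>verts H = X\<close> have "C = H"
        by (auto simp: subgraph_def compatible_def C_def intro!: pre_digraph.equality)
      with H(1) show False ..
    qed
  qed
  then show "set es = set es'"
    using assms(2) cyc[OF c vsX] cyc[OF c' vsX'] unfolding pseudoforest_def undirected_cycles_def by blast
qed

section \<open>Invariant systems of lines\<close>

text \<open>A representation of the quiver \<open>G\<close> with the space of dimension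
  \<open>r v\<close> at \<open>v\<close>.\<close>

locale matrix_rep =
  fixes G :: "('a, 'b) pre_digraph" and r :: "'a \<Rightarrow> nat" and A :: "'b \<Rightarrow> complex mat"
  assumes finite_arcs: "finite (arcs G)"
    and carrier: "e \<in> arcs G \<Longrightarrow> A e \<in> carrier_mat (r (head G e)) (r (tail G e))"
begin

text \<open>The systems of lines described at the outset, each line given by a spanning vector. The
  factor \<open>c\<close> may be 0, so a line may also be killed inside \<open>S\<close>. The
  parameter \<open>E\<close> allows arcs to be imposed one at a time.\<close>

definition admissible :: "'b set \<Rightarrow> 'a set \<Rightarrow> ('a \<Rightarrow> complex vec) \<Rightarrow> bool" where
  "admissible E S L \<longleftrightarrow>
     (\<forall>v \<in> S. L v \<in> carrier_vec (r v) \<and> L v \<noteq> 0\<^sub>v (r v)) \<and>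
     (\<forall>e \<in> E.
        (tail G e \<in> S \<longrightarrow> head G e \<in> S \<longrightarrow> (\<exists>c. A e *\<^sub>v L (tail G e) = c \<cdot>\<^sub>v L (head G e))) \<and>
        (tail G e \<in> S \<longrightarrow> head G e \<notin> S \<longrightarrow> A e *\<^sub>v L (tail G e) = 0\<^sub>v (r (head G e))) \<and>
        (tail G e \<notin> S \<longrightarrow> head G e \<in> S \<longrightarrow> r (tail G e) < r (head G e)))"

text \<open>No arc of \<open>E\<close> touches \<open>y\<close>, so \<open>y\<close> can be treated
  freely. If \<open>x\<close> has no line, \<open>y\<close> gets none. Otherwise a forward arc gives
  \<open>y\<close> the image line, or no line if the image is 0; a backward arc gives
  \<open>y\<close> a preimage line, or no line if \<open>r y < r x\<close>.\<close>

lemma admissible_add_arc: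
  assumes adm: "admissible E S L" and SW: "S \<subseteq> W"
    and ends: "\<And>f. f \<in> E \<Longrightarrow> tail G f \<in> W \<and> head G f \<in> W"
    and e: "joins G e x y" and W: "x \<in> W" "y \<notin> W"
  obtains S' L' where "admissible (insert e E) S' L'" "S \<subseteq> S'" "S' \<subseteq> insert y W"
    "\<And>v. v \<in> S \<Longrightarrow> L' v = L v"
proof -
  note result = that
  have yS: "y \<notin> S" using SW W by blast
  have xy: "x \<noteq> y" using W by blast
  have car: "A e \<in> carrier_mat (r (head G e)) (r (tail G e))"
    using carrier e by (auto simp: joins_def)
  have ext: "admissible E (insert y S) (L(y := z))" if "z \<in> carrier_vec (r y)" "z \<noteq> 0\<^sub>v (r y)" for z
  proof -
    have "tail G f \<noteq> y" "head G f \<noteq> y" if "f \<in> E" for f using ends[OF that] W by auto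
    with adm that show ?thesis unfolding admissible_def by simp
  qed
  show thesis
  proof (cases "x \<in> S")
    case False
    then have "admissible (insert e E) S L"
      using adm yS e unfolding admissible_def by (auto simp: joins_def)
    then show thesis using SW by (intro that[of S L]) auto
  next
    case x: True
    then have Lx: "L x \<in> carrier_vec (r x)" "L x \<noteq> 0\<^sub>v (r x)" using adm by (auto simp: admissible_def)
    have new: thesis if z: "z \<in> carrier_vec (r y)" "z \<noteq> 0\<^sub>v (r y)"
      and "admissible {e} (insert y S) (L(y := z))" for z
    proof (rule result)
      show "admissible (insert e E) (insert y S) (L(y := z))"
        using ext[OF z] \<open>admissible {e} _ _\<close> unfolding admissible_def by blast
    qed (use SW yS in auto)
    have stop: thesis if "admissible {e} S L"
    proof (rule result)
      show "admissible (insert e E) S L" using adm that unfolding admissible_def by blast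
    qed (use SW in auto)
    from e consider "tail G e = x" "head G e = y" | "tail G e = y" "head G e = x"
      by (auto simp: joins_def)
    then show thesis
    proof cases
      case 1
      have Ax: "A e *\<^sub>v L x \<in> carrier_vec (r y)" using car Lx 1 by simp
      show thesis
      proof (cases "A e *\<^sub>v L x = 0\<^sub>v (r y)")
        case True
        show thesis by (rule stop) (use adm 1 x yS True in \<open>auto simp: admissible_def\<close>)
      next
        case False
        have "\<exists>c. A e *\<^sub>v L x = c \<cdot>\<^sub>v (A e *\<^sub>v L x)" by (rule exI[of _ 1]) simp
        then show thesis
          by (intro new[OF Ax False]) (use adm 1 x xy Ax False in \<open>auto simp: admissible_def\<close>)
      qed
    next
      case 2
      show thesis
      proof (cases "r y < r x")
        case True
        show thesis by (rule stop) (use adm 2 x yS True in \<open>auto simp: admissible_def\<close>)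
      next
        case False
        then obtain z c where z: "z \<in> carrier_vec (r y)" "z \<noteq> 0\<^sub>v (r y)" "A e *\<^sub>v z = c \<cdot>\<^sub>v L x"
          using exists_preimage_line[of "A e" "r x" "r y" "L x"] car Lx 2 by auto
        show thesis
          by (rule new[OF z(1,2)]) (use adm 2 x xy z in \<open>auto simp: admissible_def\<close>)
      qed
    qed
  qed
qed

text \<open>\<open>W0\<close> holds the vertices already decided, \<open>S0\<close> those among them
  that carry a line. The last hypothesis says that all cycles within reach are already in
  \<open>E0\<close>, so an arc of \<open>E - E0\<close> touching \<open>W0\<close> leads to a new
  vertex. Once no such arc is left, the remaining arcs do not meet \<open>S0\<close> and impose
  nothing.\<close>

lemma admissible_extend:
  assumes "E0 \<subseteq> E" "E \<subseteq> arcs G" "admissible E0 S0 L0" "S0 \<subseteq> W0"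
    and "\<And>u v. u \<in> W0 \<Longrightarrow> v \<in> W0 \<Longrightarrow> (u, v) \<in> (link G E0)\<^sup>*"
    and "\<And>e. e \<in> E0 \<Longrightarrow> tail G e \<in> W0 \<and> head G e \<in> W0"
    and "\<And>vs es u v. undirected_cycle G vs es \<Longrightarrow> set es \<subseteq> E \<Longrightarrow> u \<in> W0 \<Longrightarrow> v \<in> set vs \<Longrightarrow>
       (u, v) \<in> (link G E)\<^sup>* \<Longrightarrow> set es \<subseteq> E0"
  shows "\<exists>S L. admissible E S L \<and> S0 \<subseteq> S \<and> (\<forall>v \<in> S0. L v = L0 v) \<and>
    (\<forall>v \<in> S. \<exists>u \<in> W0. (u, v) \<in> (link G E)\<^sup>*)"
  using assms
proof (induction "card (E - E0)" arbitrary: E0 S0 L0 W0 rule: less_induct)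
  case less
  note adm = less.prems(3) and SW = less.prems(4) and conn = less.prems(5)
    and ends = less.prems(6) and cyc = less.prems(7)
  show ?case
  proof (cases "\<exists>e \<in> E - E0. tail G e \<in> W0 \<or> head G e \<in> W0")
    case False
    then have "tail G e \<notin> S0 \<and> head G e \<notin> S0" if "e \<in> E - E0" for e using that SW by blast
    then have "admissible E S0 L0" using adm unfolding admissible_def by (metis DiffI)
    then show ?thesis using SW by (intro exI[of _ S0] exI[of _ L0]) auto
  next
    case True
    then obtain e x y where e: "e \<in> E" "e \<notin> E0" "joins G e x y" "x \<in> W0"
      using less.prems(2) unfolding joins_def by blast
    have y: "y \<notin> W0"
    proof
      assume "y \<in> W0"
      then have "(x, y) \<in> (link G E0)\<^sup>*" using conn e by blast
      from chord_closes_cycle[OF this e(2,3)] obtain vs es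
        where c: "undirected_cycle G vs es" "set es \<subseteq> insert e E0" "e \<in> set es" "x \<in> set vs" .
      then have "set es \<subseteq> E" using e(1) less.prems(1) by blast
      then have "set es \<subseteq> E0" using cyc[OF c(1) _ e(4) c(4)] by blast
      then show False using c(3) e(2) by blast
    qed
    obtain S1 L1 where 1: "admissible (insert e E0) S1 L1" "S0 \<subseteq> S1" "S1 \<subseteq> insert y W0"
      "\<And>v. v \<in> S0 \<Longrightarrow> L1 v = L0 v"
      using admissible_add_arc[OF adm SW ends e(3,4) y] by blast
    have fin: "finite (E - E0)"
      using less.prems(2) finite_arcs by (meson Diff_subset finite_subset)
    have xy0: "(x, y) \<in> link G (insert e E0)" using e(3) by (auto simp: link_def)
    then have xy: "(x, y) \<in> (link G (insert e E0))\<^sup>*" by blast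
    have ins: "(link G (insert e E0))\<^sup>* \<subseteq> (link G E)\<^sup>*"
      using e(1) less.prems(1) by (intro link_mono) auto
    have E0: "(link G E0)\<^sup>* \<subseteq> (link G (insert e E0))\<^sup>*" by (intro link_mono) auto
    have to_x: "(x, u) \<in> (link G (insert e E0))\<^sup>*" if "u \<in> insert y W0" for u
      using that xy conn[OF e(4)] E0 by blast
    have "\<exists>S L. admissible E S L \<and> S1 \<subseteq> S \<and> (\<forall>v \<in> S1. L v = L1 v) \<and>
      (\<forall>v \<in> S. \<exists>u \<in> insert y W0. (u, v) \<in> (link G E)\<^sup>*)"
    proof (rule less.hyps[OF _ _ less.prems(2) 1(1,3)])
      show "card (E - insert e E0) < card (E - E0)"
        using fin e(1,2) by (intro psubset_card_mono) auto
      show "insert e E0 \<subseteq> E" using e(1) less.prems(1) by auto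
      show "(u, v) \<in> (link G (insert e E0))\<^sup>*" if "u \<in> insert y W0" "v \<in> insert y W0" for u v
        using to_x[OF that(1)] to_x[OF that(2)] link_sym rtrancl_trans by metis
      show "tail G f \<in> insert y W0 \<and> head G f \<in> insert y W0" if "f \<in> insert e E0" for f
        using that ends e by (auto simp: joins_def)
      show "set es \<subseteq> insert e E0" if "undirected_cycle G vs es" "set es \<subseteq> E" "u \<in> insert y W0"
        "v \<in> set vs" "(u, v) \<in> (link G E)\<^sup>*" for vs es u v
      proof -
        have "(x, v) \<in> (link G E)\<^sup>*"
          using to_x[OF that(3)] ins that(5) by (meson rtrancl_trans subsetD)
        from cyc[OF that(1,2) e(4) that(4) this] show ?thesis by blast
      qed
    qed
    then obtain S L where 2: "admissible E S L" "S1 \<subseteq> S" "\<forall>v \<in> S1. L v = L1 v"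
      "\<forall>v \<in> S. \<exists>u \<in> insert y W0. (u, v) \<in> (link G E)\<^sup>*" by blast
    \<comment> \<open>The induction may return \<open>y\<close> as starting point; \<open>x\<close>,
      which is linked to it, serves instead.\<close>
    have "\<exists>u \<in> W0. (u, v) \<in> (link G E)\<^sup>*" if v: "v \<in> S" for v
    proof -
      obtain u where u: "u \<in> insert y W0" "(u, v) \<in> (link G E)\<^sup>*" using 2(4) v by blast
      have "(x, u) \<in> (link G E)\<^sup>*" using to_x[OF u(1)] ins by (rule subsetD[rotated])
      from this u(2) have "(x, v) \<in> (link G E)\<^sup>*" by (rule rtrancl_trans)
      with e(4) show ?thesis by blast
    qed
    then show ?thesis using 1 2 by (intro exI[of _ S] exI[of _ L]) auto
  qed
qed

lemma admissible_from_vertex: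
  assumes "E \<subseteq> arcs G" and "l \<in> carrier_vec (r w)" "l \<noteq> 0\<^sub>v (r w)"
    and "\<And>vs es v. undirected_cycle G vs es \<Longrightarrow> set es \<subseteq> E \<Longrightarrow> v \<in> set vs \<Longrightarrow>
       (w, v) \<notin> (link G E)\<^sup>*"
  obtains S L where "admissible E S L" "w \<in> S" "L w = l" "\<And>v. v \<in> S \<Longrightarrow> (w, v) \<in> (link G E)\<^sup>*"
proof -
  have "\<exists>S L. admissible E S L \<and> {w} \<subseteq> S \<and> (\<forall>v \<in> {w}. L v = l) \<and>
    (\<forall>v \<in> S. \<exists>u \<in> {w}. (u, v) \<in> (link G E)\<^sup>*)"
    by (rule admissible_extend[where ?E0.0 = "{}" and ?S0.0 = "{w}" and ?W0.0 = "{w}" and ?L0.0 = "\<lambda>_. l"]) (use assms in \<open>auto simp: admissible_def\<close>)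
  then show thesis using that by blast
qed

text \<open>By \<open>min\<close>, a proper subset of the cycle's edges contains no cycle. So once
  some arcs are dropped, growth from any line at any vertex succeeds (\<open>broken\<close>); the
  dropped arcs are then checked separately.\<close>

lemma admissible_cycle:
  assumes cyc: "undirected_cycle G vs es"
    and min: "\<And>vs' es'. undirected_cycle G vs' es' \<Longrightarrow> set es' \<subseteq> set es \<Longrightarrow> set es' = set es"
    and pos: "\<And>v. v \<in> set vs \<Longrightarrow> 0 < r v"
  obtains S L where "admissible (set es) S L" "S \<noteq> {}" "S \<subseteq> set vs"
proof -
  have ends: "e \<in> arcs G" "tail G e \<in> set vs" "head G e \<in> set vs" if "e \<in> set es" for e
    using undirected_cycle_ends[OF cyc that] by auto
  have car: "A e \<in> carrier_mat (r (head G e)) (r (tail G e))" if "e \<in> set es" for e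
    using carrier ends(1)[OF that] .
  have broken: "\<exists>S L. admissible E S L \<and> w \<in> S \<and> L w = l \<and> S \<subseteq> set vs \<and> (\<forall>v \<in> S. (w, v) \<in> (link G E)\<^sup>*)"
    if E: "E \<subset> set es" and w: "w \<in> set vs" and l: "l \<in> carrier_vec (r w)" "l \<noteq> 0\<^sub>v (r w)" for E w l
  proof -
    have no_cycle: "\<not> set es' \<subseteq> E" if "undirected_cycle G vs' es'" for vs' es'
      using min[OF that] E by blast
    have "E \<subseteq> arcs G" using E ends(1) by blast
    from admissible_from_vertex[OF this l] no_cycle obtain S L where
      SL: "admissible E S L" "w \<in> S" "L w = l" "\<And>v. v \<in> S \<Longrightarrow> (w, v) \<in> (link G E)\<^sup>*" by metis
    moreover have "S \<subseteq> set vs"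
    proof
      fix v assume "v \<in> S"
      then have "(w, v) \<in> (link G (set es))\<^sup>*" using SL(4) link_mono[of E "set es" G] E by blast
      then show "v \<in> set vs" using linked_in_cycle[OF cyc] w by blast
    qed
    ultimately show ?thesis by blast
  qed
  show thesis
  proof (cases "\<exists>e \<in> set es. \<exists>z \<in> carrier_vec (r (tail G e)). z \<noteq> 0\<^sub>v (r (tail G e)) \<and> A e *\<^sub>v z = 0\<^sub>v (r (head G e))")
    case True
    then obtain e z where e: "e \<in> set es"
      and z: "z \<in> carrier_vec (r (tail G e))" "z \<noteq> 0\<^sub>v (r (tail G e))" "A e *\<^sub>v z = 0\<^sub>v (r (head G e))"
      by blast
    \<comment> \<open>Starting at the tail of \<open>e\<close> with a kernel vector makes
      \<open>e\<close> harmless, whether or not its head ends up in \<open>S\<close>.\<close>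
    obtain S L where SL: "admissible (set es - {e}) S L" "tail G e \<in> S" "L (tail G e) = z" "S \<subseteq> set vs"
      using broken[OF _ ends(2)[OF e] z(1,2), of "set es - {e}"] e by blast
    have "A e *\<^sub>v L (tail G e) = 0 \<cdot>\<^sub>v L (head G e)" if "head G e \<in> S"
    proof -
      have "L (head G e) \<in> carrier_vec (r (head G e))" using SL(1) that by (auto simp: admissible_def)
      then have "0 \<cdot>\<^sub>v L (head G e) = 0\<^sub>v (r (head G e))" by (intro eq_vecI) auto
      then show ?thesis using SL(3) z(3) by simp
    qed
    then have "admissible {e} S L"
      using SL z(3) unfolding admissible_def by auto
    with SL(1) have "admissible (set es) S L" unfolding admissible_def by blast
    then show thesis using SL by (intro that[of S L]) auto
  next
    case False
    then have injective: "z = 0\<^sub>v (r (tail G e))" if "e \<in> set es" "z \<in> carrier_vec (r (tail G e))"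
      "A e *\<^sub>v z = 0\<^sub>v (r (head G e))" for e z
      using that by blast
    have le: "r (tail G e) \<le> r (head G e)" if e: "e \<in> set es" for e
    proof (rule ccontr)
      assume "\<not> ?thesis"
      then have "r (head G e) < r (tail G e)" by simp
      from exists_kernel_vec[OF car[OF e] this] obtain z where z: "z \<in> carrier_vec (r (tail G e))"
        "z \<noteq> 0\<^sub>v (r (tail G e))" "A e *\<^sub>v z = 0\<^sub>v (r (head G e))" .
      from injective[OF e z(1,3)] z(2) show False by simp
    qed
    show thesis
    proof (cases "\<exists>e \<in> set es. r (tail G e) < r (head G e)")
      case True
      define D where "D = {e \<in> set es. r (tail G e) < r (head G e)}"
      have "finite (r ` set vs)" "r ` set vs \<noteq> {}" using cyc by (auto simp: undirected_cycle_def)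
      then have "Max (r ` set vs) \<in> r ` set vs" by (rule Max_in)
      then obtain j where j: "j \<in> set vs" "Max (r ` set vs) = r j" by blast
      have max: "r v \<le> r j" if "v \<in> set vs" for v
        using that j(2) by (metis List.finite_set Max_ge finite_imageI image_eqI)
      have l: "unit_vec (r j) 0 \<in> carrier_vec (r j)" "unit_vec (r j) 0 \<noteq> (0\<^sub>v (r j) :: complex vec)"
        using pos[OF j(1)] by auto
      obtain S L where SL: "admissible (set es - D) S L" "j \<in> S" "S \<subseteq> set vs"
        "\<forall>v \<in> S. (j, v) \<in> (link G (set es - D))\<^sup>*"
        using broken[OF _ j(1) l, of "set es - D"] True D_def by blast
      \<comment> \<open>By \<open>le\<close>, the arcs outside \<open>D\<close> preserve the
        dimension, so every vertex reached has the maximal one.\<close>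
      have eq: "r v = r j" if "(j, v) \<in> (link G (set es - D))\<^sup>*" for v
        using that
      proof (induction rule: rtrancl_induct)
        case (step y z)
        then obtain e where "e \<in> set es" "e \<notin> D" "joins G e y z" by (auto simp: link_def)
        then show ?case using le[of e] step.IH by (auto simp: D_def joins_def)
      qed simp
      \<comment> \<open>An arc of \<open>D\<close> leaving \<open>S\<close> would end at a vertex of
        larger than maximal dimension.\<close>
      have D: "tail G e \<notin> S \<and> r (tail G e) < r (head G e)" if "e \<in> D" for e
        using that eq[of "tail G e"] SL(4) max[OF ends(3), of e] by (auto simp: D_def)
      have "admissible (set es) S L"
        unfolding admissible_def
      proof (intro conjI ballI)
        fix e assume "e \<in> set es"
        then show "tail G e \<in> S \<longrightarrow> head G e \<in> S \<longrightarrow> (\<exists>c. A e *\<^sub>v L (tail G e) = c \<cdot>\<^sub>v L (head G e))"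
          "tail G e \<in> S \<longrightarrow> head G e \<notin> S \<longrightarrow> A e *\<^sub>v L (tail G e) = 0\<^sub>v (r (head G e))"
          "tail G e \<notin> S \<longrightarrow> head G e \<in> S \<longrightarrow> r (tail G e) < r (head G e)"
          using D[of e] SL(1) by (cases "e \<in> D"; simp add: admissible_def)+
      qed (use SL(1) in \<open>simp_all add: admissible_def\<close>)
      then show thesis using SL by (intro that[of S L]) auto
    next
      case False
      then have sq: "r (tail G e) = r (head G e)" if "e \<in> set es" for e using le that by force
      define n where "n = length vs"
      define d where "d = r (vs ! 0)"
      have n: "0 < n" "length es = n" "distinct vs" using cyc by (auto simp: undirected_cycle_def n_def)
      have dim: "r v = d" if "v \<in> set vs" for v
      proof -
        have "(vs ! 0, v) \<in> (link G (set es))\<^sup>*"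
          using undirected_cycle_linked[OF cyc] that n n_def by simp
        then show ?thesis
        proof (induction rule: rtrancl_induct)
          case (step y z)
          then show ?case using sq by (auto simp: link_def joins_def)
        qed (simp add: d_def)
      qed
      have "0 < d" using pos[of "vs ! 0"] n by (simp add: d_def n_def)
      have carA: "A e \<in> carrier_mat d d" if "e \<in> set es" for e
        using car[OF that] dim ends[OF that] by simp
      have "\<exists>B. B \<in> carrier_mat d d \<and> A e * B = 1\<^sub>m d \<and> B * A e = 1\<^sub>m d" if "e \<in> set es" for e
      proof -
        have "det (A e) \<noteq> 0"
          using det_0_iff_vec_prod_zero[OF carA[OF that]] injective[OF that] dim[OF ends(2)[OF that]]
            dim[OF ends(3)[OF that]] by metis
        from det_non_zero_imp_unit[OF carA[OF that] this, of undefined]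
        show ?thesis by (auto simp: Units_def ring_mat_def)
      qed
      then obtain B where B: "\<And>e. e \<in> set es \<Longrightarrow> B e \<in> carrier_mat d d"
        "\<And>e. e \<in> set es \<Longrightarrow> A e * B e = 1\<^sub>m d" "\<And>e. e \<in> set es \<Longrightarrow> B e * A e = 1\<^sub>m d"
        by metis
      \<comment> \<open>Tells whether the cycle traverses its arc number \<open>i\<close> along its
        direction; \<open>K i\<close> then transports vectors from \<open>vs ! i\<close> to the next
        vertex.\<close>
      define fwd where "fwd i \<longleftrightarrow> tail G (es ! i) = vs ! i \<and> head G (es ! i) = vs ! (Suc i mod n)" for i
      define K where "K i = (if fwd i then A (es ! i) else B (es ! i))" for i
      define M where "M = rec_nat (1\<^sub>m d) (\<lambda>i m. K i * m)"
      have M0: "M 0 = 1\<^sub>m d" and MS: "M (Suc i) = K i * M i" for i by (simp_all add: M_def)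
      have K: "K i \<in> carrier_mat d d" if "i < n" for i
        using that n carA B(1) by (simp add: K_def)
      have M: "M i \<in> carrier_mat d d" if "i \<le> n" for i
        using that
      proof (induction i)
        case (Suc i)
        then show ?case using K[of i] by (simp add: MS mult_carrier_mat)
      qed (simp add: M0)
      \<comment> \<open>\<open>M n\<close> is the transport once round the cycle. The vectors
        \<open>N i\<close> obtained from an eigenvector span lines that match up when the cycle
        closes.\<close>
      obtain \<mu> where "eigenvalue (M n) \<mu>"
        using spectrum_non_empty[OF M[of n] \<open>0 < d\<close>] by (auto simp: spectrum_def)
      then obtain x where x: "x \<in> carrier_vec d" "x \<noteq> 0\<^sub>v d" "M n *\<^sub>v x = \<mu> \<cdot>\<^sub>v x"
        using M[of n] by (auto simp: eigenvalue_def eigenvector_def)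
      define N where "N i = M i *\<^sub>v x" for i
      have N: "N i \<in> carrier_vec d" if "i \<le> n" for i using M[OF that] x by (simp add: N_def)
      have NS: "N (Suc i) = K i *\<^sub>v N i" if "i < n" for i
        using K[OF that] M[of i] that x by (simp add: N_def MS assoc_mult_mat_vec[of _ d d _ d])
      have N_fwd: "A (es ! i) *\<^sub>v N i = N (Suc i)" if "i < n" "fwd i" for i
        using NS[OF that(1)] that(2) by (simp add: K_def)
      have N_bwd: "A (es ! i) *\<^sub>v N (Suc i) = N i" if "i < n" "\<not> fwd i" for i
      proof -
        have i: "es ! i \<in> set es" using that n by simp
        have "A (es ! i) *\<^sub>v N (Suc i) = (A (es ! i) * B (es ! i)) *\<^sub>v N i"
          using NS[OF that(1)] that carA[OF i] B(1)[OF i] N[of i]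
          by (simp add: K_def assoc_mult_mat_vec[of _ d d _ d])
        then show ?thesis using B(2)[OF i] N[of i] that by simp
      qed
      have N_nz: "N i \<noteq> 0\<^sub>v d" if "i \<le> n" for i
        using that
      proof (induction i)
        case (Suc i)
        have i: "es ! i \<in> set es" using Suc n by simp
        show ?case
        proof (cases "fwd i")
          case True
          have "A (es ! i) *\<^sub>v N i \<noteq> 0\<^sub>v d"
            using injective[OF i, of "N i"] Suc N[of i] dim[OF ends(2)[OF i]] dim[OF ends(3)[OF i]] by auto
          then show ?thesis using N_fwd[of i] True Suc by simp
        next
          case False
          have "A (es ! i) *\<^sub>v 0\<^sub>v d = 0\<^sub>v d" using carA[OF i] by auto
          then show ?thesis using N_bwd[OF _ False] Suc by auto
        qed
      qed (use x in \<open>simp add: N_def M0\<close>)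
      have Nn: "N n = \<mu> \<cdot>\<^sub>v N 0" using x by (simp add: N_def M0)
      have "0 \<cdot>\<^sub>v N 0 = 0\<^sub>v d" using N[of 0] by (intro eq_vecI) auto
      \<comment> \<open>Needed if the closing arc is traversed backwards, where \<open>\<mu>\<close>
        is divided by.\<close>
      then have "\<mu> \<noteq> 0" using N_nz[of n] Nn by auto
      define L where "L v = N (SOME i. i < n \<and> vs ! i = v)" for v
      have L: "L (vs ! i) = N i" if "i < n" for i
      proof -
        have "(SOME i'. i' < n \<and> vs ! i' = vs ! i) = i"
          using that n(3) by (intro some_equality) (auto simp: n_def nth_eq_iff_index_eq)
        then show ?thesis by (simp add: L_def)
      qed
      have "\<exists>c. A e *\<^sub>v L (tail G e) = c \<cdot>\<^sub>v L (head G e)" if e: "e \<in> set es" for e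
      proof -
        obtain i where i: "i < n" "e = es ! i" using e n by (auto simp: in_set_conv_nth)
        have j: "joins G e (vs ! i) (vs ! (Suc i mod n))"
          using cyc i by (auto simp: undirected_cycle_def n_def)
        have "Suc i mod n < n" using n by simp
        \<comment> \<open>Only the return to \<open>vs ! 0\<close> introduces the
          eigenvalue.\<close>
        have next_vec: "N (Suc i) = (if Suc i = n then \<mu> else 1) \<cdot>\<^sub>v L (vs ! (Suc i mod n))"
          using i L[of "Suc i mod n"] Nn n by auto
        show ?thesis
        proof (cases "fwd i")
          case True
          then have "A e *\<^sub>v L (tail G e) = (if Suc i = n then \<mu> else 1) \<cdot>\<^sub>v L (head G e)"
            using N_fwd[OF i(1) True] next_vec L[OF i(1)] i(2) by (simp add: fwd_def)
          then show ?thesis ..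
        next
          case False
          then have th: "tail G e = vs ! (Suc i mod n)" "head G e = vs ! i"
            using j i(2) by (auto simp: fwd_def joins_def)
          let ?c = "if Suc i = n then \<mu> else 1"
          have "?c \<noteq> 0" using \<open>\<mu> \<noteq> 0\<close> by simp
          have Lc: "L (tail G e) \<in> carrier_vec d" using L N \<open>Suc i mod n < n\<close> th by simp
          have "N i = ?c \<cdot>\<^sub>v (A e *\<^sub>v L (tail G e))"
            using N_bwd[OF i(1) False] next_vec i(2) th mult_mat_vec[OF carA[OF e] Lc] by metis
          then have "A e *\<^sub>v L (tail G e) = (1 / ?c) \<cdot>\<^sub>v N i"
            using \<open>?c \<noteq> 0\<close> by (simp add: smult_smult_assoc)
          then have "A e *\<^sub>v L (tail G e) = (1 / ?c) \<cdot>\<^sub>v L (head G e)" using L[OF i(1)] th by simp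
          then show ?thesis ..
        qed
      qed
      moreover have "L v \<in> carrier_vec (r v) \<and> L v \<noteq> 0\<^sub>v (r v)" if v: "v \<in> set vs" for v
      proof -
        obtain i where "i < n" "v = vs ! i" using v by (auto simp: in_set_conv_nth n_def)
        then show ?thesis using L N N_nz dim[OF v] by simp
      qed
      ultimately have "admissible (set es) (set vs) L"
        unfolding admissible_def using ends by simp
      moreover have "set vs \<noteq> {}" using n by (auto simp: n_def)
      ultimately show thesis by (intro that[of "set vs" L]) auto
    qed
  qed
qed

text \<open>Arcs with an end of dimension 0 are set aside. If the rest \<open>E\<close> contains a
  cycle, all its vertices have positive dimension and the growth starts from it; otherwise it starts
  from any line at \<open>w\<close>.\<close>

lemma exists_admissible:
  assumes uni: "unicyclic_components G" and ends: "\<And>e. e \<in> arcs G \<Longrightarrow> tail G e \<in> V \<and> head G e \<in> V"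
    and w: "w \<in> V" "0 < r w"
  obtains S L where "admissible (arcs G) S L" "S \<noteq> {}" "S \<subseteq> V"
proof -
  define E where "E = {e \<in> arcs G. 0 < r (tail G e) \<and> 0 < r (head G e)}"
  have E: "E \<subseteq> arcs G" by (auto simp: E_def)
  have reach: "v \<in> V" if "(u, v) \<in> (link G E)\<^sup>*" "u \<in> V" for u v
    using that
  proof (induction rule: rtrancl_induct)
    case (step y z)
    then show ?case using ends E by (auto simp: link_def joins_def)
  qed simp
  have "\<exists>S L. admissible E S L \<and> S \<noteq> {} \<and> S \<subseteq> V"
  proof (cases "\<exists>vs es. undirected_cycle G vs es \<and> set es \<subseteq> E")
    case True
    then obtain vs es where c: "undirected_cycle G vs es" and es: "set es \<subseteq> E" by blast
    have vs: "0 < r v \<and> v \<in> V" if "v \<in> set vs" for v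
    proof -
      from \<open>v \<in> set vs\<close> obtain i where i: "i < length vs" "v = vs ! i" by (auto simp: in_set_conv_nth)
      then have "es ! i \<in> E" "joins G (es ! i) v (vs ! (Suc i mod length vs))"
        using c es by (auto simp: undirected_cycle_def)
      then show ?thesis using ends by (auto simp: E_def joins_def)
    qed
    have uniq: "set es' = set es" if "undirected_cycle G vs' es'" "u \<in> set vs" "v \<in> set vs'"
      "(u, v) \<in> (link G (arcs G))\<^sup>*" for vs' es' u v
      using uni c that unfolding unicyclic_components_def by blast
    \<comment> \<open>A cycle made of edges of \<open>es\<close> shares a vertex with the cycle
      \<open>es\<close>, so uniqueness applies.\<close>
    have min: "set es' = set es" if c': "undirected_cycle G vs' es'" and sub: "set es' \<subseteq> set es" for vs' es'
    proof -
      have "es' \<noteq> []" using c' by (auto simp: undirected_cycle_def)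
      then have "hd es' \<in> set es'" by simp
      then have "tail G (hd es') \<in> set vs'" "tail G (hd es') \<in> set vs"
        using undirected_cycle_ends[OF c'] undirected_cycle_ends[OF c] sub by auto
      then show ?thesis using uniq[OF c'] by blast
    qed
    have "\<exists>S0 L0. admissible (set es) S0 L0 \<and> S0 \<noteq> {} \<and> S0 \<subseteq> set vs"
      by (rule admissible_cycle[OF c]) (use min vs in blast)+
    then obtain S0 L0 where 0: "admissible (set es) S0 L0" "S0 \<noteq> {}" "S0 \<subseteq> set vs" by blast
    have "\<exists>S L. admissible E S L \<and> S0 \<subseteq> S \<and> (\<forall>v \<in> S0. L v = L0 v) \<and>
      (\<forall>v \<in> S. \<exists>u \<in> set vs. (u, v) \<in> (link G E)\<^sup>*)"
    proof (rule admissible_extend[OF es E 0(1,3)])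
      show "(u, v) \<in> (link G (set es))\<^sup>*" if "u \<in> set vs" "v \<in> set vs" for u v
        by (rule undirected_cycle_linked[OF c that])
      show "tail G e \<in> set vs \<and> head G e \<in> set vs" if "e \<in> set es" for e
        using undirected_cycle_ends[OF c that] by blast
      show "set es' \<subseteq> set es" if "undirected_cycle G vs' es'" "u \<in> set vs" "v \<in> set vs'"
        "(u, v) \<in> (link G E)\<^sup>*" for vs' es' u v
        using uniq[OF that(1-3)] that(4) link_mono[OF E, of G] by blast
    qed
    then obtain S L where S: "admissible E S L" "S0 \<subseteq> S"
      "\<forall>v \<in> S. \<exists>u \<in> set vs. (u, v) \<in> (link G E)\<^sup>*" by blast
    have "S \<subseteq> V" using S(3) vs reach by blast
    with S 0(2) show ?thesis by blast
  next
    case False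
    have "unit_vec (r w) 0 \<in> carrier_vec (r w)" "unit_vec (r w) 0 \<noteq> (0\<^sub>v (r w) :: complex vec)"
      using w(2) by auto
    from admissible_from_vertex[OF E this] False obtain S L
      where S: "admissible E S L" "w \<in> S" "\<And>v. v \<in> S \<Longrightarrow> (w, v) \<in> (link G E)\<^sup>*" by metis
    have "S \<subseteq> V" using S(3) reach w(1) by blast
    with S show ?thesis by blast
  qed
  then obtain S L where S: "admissible E S L" "S \<noteq> {}" "S \<subseteq> V" by blast
  have pos: "0 < r v" if "v \<in> S" for v
  proof (rule ccontr)
    assume "\<not> 0 < r v"
    moreover have "L v \<in> carrier_vec (r v)" "L v \<noteq> 0\<^sub>v (r v)" using S(1) that by (auto simp: admissible_def)
    ultimately show False by auto
  qed
  have "admissible (arcs G) S L"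
    unfolding admissible_def
  proof (intro conjI ballI)
    fix e assume e: "e \<in> arcs G"
    show "tail G e \<in> S \<longrightarrow> head G e \<in> S \<longrightarrow> (\<exists>c. A e *\<^sub>v L (tail G e) = c \<cdot>\<^sub>v L (head G e))"
      using S(1) pos[of "tail G e"] pos[of "head G e"] e by (cases "e \<in> E") (auto simp: admissible_def E_def)
    show "tail G e \<notin> S \<longrightarrow> head G e \<in> S \<longrightarrow> r (tail G e) < r (head G e)"
      using S(1) pos[of "tail G e"] pos[of "head G e"] e by (cases "e \<in> E") (auto simp: admissible_def E_def)
    show "tail G e \<in> S \<longrightarrow> head G e \<notin> S \<longrightarrow> A e *\<^sub>v L (tail G e) = 0\<^sub>v (r (head G e))"
    proof (cases "e \<in> E")
      case True
      then show ?thesis using S(1) by (auto simp: admissible_def)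
    next
      case False
      \<comment> \<open>Vertices of \<open>S\<close> have positive dimension, so it is the head that
        has dimension 0, and there every vector is 0.\<close>
      then have "r (head G e) = 0" if "tail G e \<in> S" using pos[OF that] e by (simp add: E_def)
      then show ?thesis using carrier[OF e] by (auto intro!: eq_vecI)
    qed
  qed (use S(1) in \<open>simp_all add: admissible_def\<close>)
  with S(2,3) that show thesis by blast
qed

end

section \<open>Triangularization\<close>

text \<open>\<open>B\<close> is block upper triangular, and the block diagonal matrices turn its
  lower right block \<open>B4\<close> into \<open>mat_adjoint W * B4 * V\<close> while keeping the
  lower left block 0.\<close>

lemma staircase_conjugation:
  fixes B :: "complex mat"
  assumes B: "B \<in> carrier_mat (s + p) (t + q)"
    and zero: "\<And>a b. a < p \<Longrightarrow> b < t \<Longrightarrow> B $$ (s + a, b) = 0"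
    and W: "unitary_mat p W" and V: "unitary_mat q V"
    and st: "s \<le> 1" "t \<le> 1" "s = 1 \<Longrightarrow> t = 0 \<Longrightarrow> q \<le> p"
    and stair: "staircase (mat_adjoint W * mat p q (\<lambda>(a, b). B $$ (s + a, t + b)) * V)"
  shows "staircase (mat_adjoint (four_block_mat (1\<^sub>m s) (0\<^sub>m s p) (0\<^sub>m p s) W) * B *
    four_block_mat (1\<^sub>m t) (0\<^sub>m t q) (0\<^sub>m q t) V)"
proof -
  define B1 where "B1 = mat s t (\<lambda>(a, b). B $$ (a, b))"
  define B2 where "B2 = mat s q (\<lambda>(a, b). B $$ (a, t + b))"
  define B4 where "B4 = mat p q (\<lambda>(a, b). B $$ (s + a, t + b))"
  have carr: "B1 \<in> carrier_mat s t" "B2 \<in> carrier_mat s q" "B4 \<in> carrier_mat p q"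
    by (simp_all add: B1_def B2_def B4_def)
  have WV: "W \<in> carrier_mat p p" "mat_adjoint W \<in> carrier_mat p p" "V \<in> carrier_mat q q"
    using W V by (auto simp: unitary_mat_def)
  have B_block: "B = four_block_mat B1 B2 (0\<^sub>m p t) B4"
  proof (rule eq_matI)
    fix a b assume ab: "a < dim_row (four_block_mat B1 B2 (0\<^sub>m p t) B4)"
      "b < dim_col (four_block_mat B1 B2 (0\<^sub>m p t) B4)"
    then show "B $$ (a, b) = four_block_mat B1 B2 (0\<^sub>m p t) B4 $$ (a, b)"
      using zero[of "a - s" b] carr by (auto simp: B1_def B2_def B4_def)
  qed (use B carr in auto)
  have "mat_adjoint (four_block_mat (1\<^sub>m s) (0\<^sub>m s p) (0\<^sub>m p s) W) * B
    = four_block_mat B1 B2 (0\<^sub>m p t) (mat_adjoint W * B4)"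
    unfolding unitary_mat_block(2)[OF W] B_block
    using carr WV by (subst mult_four_block_mat[of _ s s _ p _ p _ _ t _ q]) auto
  also have "\<dots> * four_block_mat (1\<^sub>m t) (0\<^sub>m t q) (0\<^sub>m q t) V
    = four_block_mat B1 (B2 * V) (0\<^sub>m p t) (mat_adjoint W * B4 * V)"
    using carr WV by (subst mult_four_block_mat[of _ s t _ q _ p _ _ t _ q]) auto
  finally have block: "mat_adjoint (four_block_mat (1\<^sub>m s) (0\<^sub>m s p) (0\<^sub>m p s) W) * B *
    four_block_mat (1\<^sub>m t) (0\<^sub>m t q) (0\<^sub>m q t) V
    = four_block_mat B1 (B2 * V) (0\<^sub>m p t) (mat_adjoint W * B4 * V)" .
  have "B2 * V \<in> carrier_mat s q" "mat_adjoint W * B4 * V \<in> carrier_mat p q"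
    using carr WV by (auto intro!: mult_carrier_mat)
  from staircase_block[OF carr(1) this stair[folded B4_def] st] show ?thesis
    unfolding block .
qed

text \<open>Induction on the total dimension with the graph fixed. The matrices \<open>Q v\<close>
  move the lines of an admissible system to the first coordinate, the induction treats the
  quotients, and the results are combined as \<open>Q v * F v\<close>.\<close>

lemma exists_staircase_form:
  assumes "fin_digraph G" "unicyclic_components G" "matrix_rep G r A"
  shows "\<exists>U. (\<forall>v \<in> verts G. unitary_mat (r v) (U v)) \<and>
    (\<forall>e \<in> arcs G. staircase (mat_adjoint (U (head G e)) * A e * U (tail G e)))"
  using assms(3)
proof (induction "\<Sum>v \<in> verts G. r v" arbitrary: r A rule: less_induct)
  case less
  interpret fin_digraph G by fact
  interpret matrix_rep G r A by fact
  show ?case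
  proof (cases "\<exists>w \<in> verts G. 0 < r w")
    case False
    then have "staircase (mat_adjoint (1\<^sub>m (r (head G e))) * A e * 1\<^sub>m (r (tail G e)))" if "e \<in> arcs G" for e
      using that head_in_verts[OF that] by (auto simp: staircase_def)
    then show ?thesis
      by (intro exI[of _ "\<lambda>v. 1\<^sub>m (r v)"]) (simp add: unitary_mat_one)
  next
    case True
    then obtain w where w: "w \<in> verts G" "0 < r w" by blast
    obtain S L where adm: "admissible (arcs G) S L" and S: "S \<noteq> {}" "S \<subseteq> verts G"
      using exists_admissible[OF assms(2) _ w] by auto
    have L: "L v \<in> carrier_vec (r v)" "L v \<noteq> 0\<^sub>v (r v)" if "v \<in> S" for v
      using adm that by (auto simp: admissible_def)
    have pos: "0 < r v" if "v \<in> S" for v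
      using L[OF that] by (cases "r v") auto
    have "\<exists>Q c. unitary_mat (r v) Q \<and> (v \<in> S \<longrightarrow> c \<noteq> 0 \<and> col Q 0 = c \<cdot>\<^sub>v L v)" for v
      using exists_unitary_mat_col_0[OF L, of v] unitary_mat_one by (metis (no_types))
    then obtain Q c where Q: "\<And>v. unitary_mat (r v) (Q v)"
      and Qc: "\<And>v. v \<in> S \<Longrightarrow> c v \<noteq> 0" "\<And>v. v \<in> S \<Longrightarrow> col (Q v) 0 = c v \<cdot>\<^sub>v L v" by metis
    have Qcar: "Q v \<in> carrier_mat (r v) (r v)" "mat_adjoint (Q v) \<in> carrier_mat (r v) (r v)" for v
      using Q[of v] by (auto simp: unitary_mat_def)
    define s where "s v = (if v \<in> S then 1 else 0 :: nat)" for v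
    define r' where "r' v = r v - s v" for v
    have r: "r v = s v + r' v" for v using pos[of v] by (auto simp: r'_def s_def)
    define B where "B e = mat_adjoint (Q (head G e)) * A e * Q (tail G e)" for e
    \<comment> \<open>The map induced on the quotients by the lines, in the bases given by
      \<open>Q\<close>.\<close>
    define A' where "A' e = mat (r' (head G e)) (r' (tail G e))
      (\<lambda>(a, b). B e $$ (s (head G e) + a, s (tail G e) + b))" for e
    have "matrix_rep G r' A'" by unfold_locales (simp_all add: A'_def)
    moreover have "(\<Sum>v \<in> verts G. r' v) < (\<Sum>v \<in> verts G. r v)"
    proof (rule sum_strict_mono_ex1)
      show "\<exists>v \<in> verts G. r' v < r v" using S pos by (force simp: r'_def s_def)
    qed (simp_all add: r'_def)
    ultimately obtain W where W: "\<And>v. v \<in> verts G \<Longrightarrow> unitary_mat (r' v) (W v)"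
      "\<And>e. e \<in> arcs G \<Longrightarrow> staircase (mat_adjoint (W (head G e)) * A' e * W (tail G e))"
      using less.hyps[of r' A'] by blast
    define F where "F v = four_block_mat (1\<^sub>m (s v)) (0\<^sub>m (s v) (r' v)) (0\<^sub>m (r' v) (s v)) (W v)" for v
    have F: "unitary_mat (r v) (F v)" if "v \<in> verts G" for v
      using unitary_mat_block(1)[OF W(1)[OF that], of "s v"] r[of v] by (simp add: F_def)
    have "staircase (mat_adjoint (Q (head G e) * F (head G e)) * A e * (Q (tail G e) * F (tail G e)))"
      if e: "e \<in> arcs G" for e
    proof -
      define k where "k = tail G e"
      define j where "j = head G e"
      have kj: "k \<in> verts G" "j \<in> verts G" using e by (auto simp: k_def j_def)
      have Ae: "A e \<in> carrier_mat (r j) (r k)" using carrier[OF e] by (simp add: k_def j_def)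
      have Be: "B e \<in> carrier_mat (r j) (r k)" 
        unfolding B_def k_def[symmetric] j_def[symmetric]
        by (rule mult_carrier_mat[OF mult_carrier_mat[OF Qcar(2) Ae] Qcar(1)])
      have Fcar: "F k \<in> carrier_mat (r k) (r k)" "F j \<in> carrier_mat (r j) (r j)"
        "mat_adjoint (F j) \<in> carrier_mat (r j) (r j)"
        using F kj by (auto simp: unitary_mat_def)
      \<comment> \<open>Here \<open>s k = 1\<close>, so \<open>b = 0\<close> and the column is a
        multiple of the image of \<open>L k\<close> in the coordinates of
        \<open>Q j\<close>.\<close>
      have lower_left: "B e $$ (s j + a, b) = 0" if a: "a < r' j" and b: "b < s k" for a b
      proof -
        have k: "k \<in> S" and b0: "b = 0" using b by (auto simp: s_def split: if_splits)
        have Lk: "L k \<in> carrier_vec (r k)" using L k by blast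
        have "B e $$ (s j + a, b) = col (B e) 0 $ (s j + a)"
          using Be a pos[OF k] r[of j] b0 by simp
        also have "col (B e) 0 = mat_adjoint (Q j) *\<^sub>v (A e *\<^sub>v col (Q k) 0)"
        proof -
          have "B e = mat_adjoint (Q j) * (A e * Q k)"
            unfolding B_def k_def[symmetric] j_def[symmetric] by (rule assoc_mult_mat[OF Qcar(2) Ae Qcar(1)])
          then show ?thesis
            using col_mult2[OF Qcar(2)[of j] mult_carrier_mat[OF Ae Qcar(1)[of k]] pos[OF k]]
              col_mult2[OF Ae Qcar(1)[of k] pos[OF k]] by simp
        qed
        also have "A e *\<^sub>v col (Q k) 0 = c k \<cdot>\<^sub>v (A e *\<^sub>v L k)"
          unfolding Qc(2)[OF k] by (rule mult_mat_vec[OF Ae Lk])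
        also have "(mat_adjoint (Q j) *\<^sub>v (c k \<cdot>\<^sub>v (A e *\<^sub>v L k))) $ (s j + a) = 0"
        proof (cases "j \<in> S")
          case False
          then have "A e *\<^sub>v L k = 0\<^sub>v (r j)"
            using adm e k by (auto simp: admissible_def k_def j_def)
          then have "c k \<cdot>\<^sub>v (A e *\<^sub>v L k) = 0\<^sub>v (r j)" by (intro eq_vecI) auto
          moreover have "mat_adjoint (Q j) *\<^sub>v 0\<^sub>v (r j) = 0\<^sub>v (r j)" 
            using Qcar(1)[of j] by (intro eq_vecI) auto
          ultimately show ?thesis using a r[of j] by simp
        next
          case j: True
          then obtain d where d: "A e *\<^sub>v L k = d \<cdot>\<^sub>v L j"
            using adm e k by (auto simp: admissible_def k_def j_def)
          \<comment> \<open>The first column of \<open>Q j\<close> spans the line at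
            \<open>j\<close>; its own coordinates are the first unit vector, which vanishes at
            position \<open>s j + a \<ge> 1\<close>.\<close>
          have "L j = (1 / c j) \<cdot>\<^sub>v col (Q j) 0"
            using Qc[OF j] by (simp add: smult_smult_assoc)
          then have "c k \<cdot>\<^sub>v (A e *\<^sub>v L k) = (c k * d / c j) \<cdot>\<^sub>v col (Q j) 0"
            unfolding d by (simp add: smult_smult_assoc)
          then have "mat_adjoint (Q j) *\<^sub>v (c k \<cdot>\<^sub>v (A e *\<^sub>v L k))
            = (c k * d / c j) \<cdot>\<^sub>v (mat_adjoint (Q j) *\<^sub>v col (Q j) 0)"
            using mult_mat_vec[OF Qcar(2)[of j] col_carrier_vec[OF pos[OF j] Qcar(1)[of j]]] by simp
          also have "mat_adjoint (Q j) *\<^sub>v col (Q j) 0 = col (1\<^sub>m (r j)) 0"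
            using col_mult2[OF Qcar(2,1) pos[OF j]] Q[of j] by (simp add: unitary_mat_def)
          finally show ?thesis
            using a r[of j] j by (simp add: s_def)
        qed
        finally show ?thesis .
      qed
      have "staircase (mat_adjoint (F j) * B e * F k)"
        unfolding F_def
      proof (rule staircase_conjugation[OF _ lower_left W(1)[OF kj(2)] W(1)[OF kj(1)]])
        show "B e \<in> carrier_mat (s j + r' j) (s k + r' k)" using Be r by simp
        show "s j \<le> 1" "s k \<le> 1" by (simp_all add: s_def)
        show "staircase (mat_adjoint (W j) * mat (r' j) (r' k) (\<lambda>(a, b). B e $$ (s j + a, s k + b)) * W k)"
          using W(2)[OF e] by (simp add: A'_def k_def j_def)
        \<comment> \<open>An arc entering \<open>S\<close> strictly increases the dimension, so the
          inequality survives the loss of one dimension at the head.\<close>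
        show "r' k \<le> r' j" if "s j = 1" "s k = 0"
        proof -
          have "j \<in> S" "k \<notin> S" using that by (auto simp: s_def split: if_splits)
          then have "r k < r j" using adm e by (auto simp: admissible_def k_def j_def)
          then show ?thesis using that by (simp add: r'_def)
        qed
      qed
      also have "mat_adjoint (F j) * B e * F k = mat_adjoint (Q j * F j) * A e * (Q k * F k)"
      proof -
        have "mat_adjoint (F j) * B e * F k = mat_adjoint (F j) * (mat_adjoint (Q j) * A e * Q k) * F k"
          by (simp add: B_def k_def j_def)
        also have "\<dots> = (mat_adjoint (F j) * mat_adjoint (Q j)) * A e * (Q k * F k)"
          using Fcar Qcar[of j] Qcar[of k] Ae
          by (simp add: assoc_mult_mat[of _ "r j" "r j" _ "r j" _ "r k"] assoc_mult_mat[of _ "r j" "r j" _ "r k" _ "r k"]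
              assoc_mult_mat[of _ "r j" "r k" _ "r k" _ "r k"] mult_carrier_mat[of _ "r j" "r j" _ "r k"]
              mult_carrier_mat[of _ "r j" "r k" _ "r k"] mult_carrier_mat[of _ "r k" "r k" _ "r k"]
              mult_carrier_mat[of _ "r j" "r j" _ "r j"])
        also have "mat_adjoint (F j) * mat_adjoint (Q j) = mat_adjoint (Q j * F j)"
          by (rule mat_adjoint_mult[OF Qcar(1) Fcar(2), symmetric])
        finally show ?thesis .
      qed
      finally show ?thesis by (simp add: k_def j_def)
    qed
    moreover have "unitary_mat (r v) (Q v * F v)" if "v \<in> verts G" for v
      using unitary_mat_mult[OF Q F[OF that]] .
    ultimately show ?thesis by (intro exI[of _ "\<lambda>v. Q v * F v"]) blast
  qed
qed

theorem theorem2: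
  fixes G :: "(nat, nat) pre_digraph" and m n :: nat
    and r :: "nat \<Rightarrow> nat" and A :: "nat \<Rightarrow> complex mat"
  assumes "fin_digraph G" and "verts G = {1..m}" and "arcs G = {1..n}"
    and "pseudoforest G"
    and "\<And>i. i \<in> {1..n} \<Longrightarrow> A i \<in> carrier_mat (r (head G i)) (r (tail G i))"
  shows "\<exists>U :: nat \<Rightarrow> complex mat.
    (\<forall>v \<in> {1..m}. unitary_mat (r v) (U v)) \<and>
    (\<forall>i \<in> {1..n}.
       mat_adjoint (U (head G i)) * A i * U (tail G i)
         \<in> carrier_mat (r (head G i)) (r (tail G i)) \<and>
       rect_upper_triangular (mat_adjoint (U (head G i)) * A i * U (tail G i)))"
proof -
  interpret fin_digraph G by fact
  have "matrix_rep G r A" by unfold_locales (use assms(3,5) in auto)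
  then obtain U where U: "\<And>v. v \<in> verts G \<Longrightarrow> unitary_mat (r v) (U v)"
    "\<And>e. e \<in> arcs G \<Longrightarrow> staircase (mat_adjoint (U (head G e)) * A e * U (tail G e))"
    using exists_staircase_form[OF assms(1) pseudoforest_imp_unicyclic_components[OF wf_digraph_axioms assms(4)]]
    by blast
  have "mat_adjoint (U (head G i)) * A i * U (tail G i) \<in> carrier_mat (r (head G i)) (r (tail G i)) \<and>
    rect_upper_triangular (mat_adjoint (U (head G i)) * A i * U (tail G i))" if "i \<in> {1..n}" for i
  proof -
    have i: "i \<in> arcs G" using that assms(3) by simp
    have "U (head G i) \<in> carrier_mat (r (head G i)) (r (head G i))"
      "U (tail G i) \<in> carrier_mat (r (tail G i)) (r (tail G i))"
      using U(1) head_in_verts[OF i] tail_in_verts[OF i] by (auto simp: unitary_mat_def)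
    then show ?thesis
      using assms(5)[OF that] staircase_imp_rect_upper_triangular[OF U(2)[OF i]]
      by (auto intro!: mult_carrier_mat)
  qed
  then show ?thesis using U(1) assms(2) by (intro exI[of _ U]) simp
qed

end
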